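(* Strongly solving a simple recursive game with $n$ terminals by a comparison-based algorithm requires $\Theta(n \log n)$ comparisons of payoffs in the worst case. That is, letting $C(n)$ denote the minimum, over all comparison-based algorithms that strongly solve all simple recursive games with $n$ terminals, of the worst-case number of comparisons made over all such games (the graph being of arbitrary finite size), one has $C(n) = \Theta(n\log n)$ as $n \to \infty$.
   Context: A simple recursive game (SRG) is a finite directed graph whose vertices are partitioned into non-terminals $V_{\mathrm{Min}}$ and $V_{\mathrm{Max}}$, belonging to players Min and Max respectively, and terminals $T$, together with a payoff function $p : T \to \mathbf{R}$. Every non-terminal has at least one outgoing arc. A play from a vertex moves a token: at a non-terminal, its owner chooses the outgoing arc along which the token moves; if a terminal $t$ is reached, the game ends and Min pays Max $p(t)$; infinite play gives payoff $0$. Standing assumptions: $p$ is injective, and the number of arcs is at least $n=|T|$ (terminals without incoming arcs are irrelevant). A positional strategy for a player is a selection of one outgoing arc for each of his vertices. Each vertex $v$ has a value $\mathrm{Val}(v)\in\mathbf{R}$: Max has a positional strategy ensuring payoff at least $\mathrm{Val}(v)$ from $v$ against every strategy of Min, and Min has a positional strategy ensuring payoff at most $\mathrm{Val}(v)$ from $v$ against every strategy of Max. To strongly solve the game is to output the list of values of all vertices (each value being specified as $0$ or as the payoff of a named terminal) together with a single positional strategy for Max that ensures payoff at least $\mathrm{Val}(v)$ from every vertex $v$, and a single positional strategy for Min that ensures payoff at most $\mathrm{Val}(v)$ from every vertex $v$. A comparison-based algorithm has full knowledge of the graph but accesses the payoffs only through comparisons of payoffs with one another and with $0$. *)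

theory Defs
  imports
    Complex_Main
    "HOL-Library.Extended_Nat"
    "HOL-Library.Landau_Symbols"
    "Graph_Theory.Pair_Digraph"
begin

section \<open>Simple recursive games\<close>

text \<open>
  An arena is the part of a game that an algorithm knows in full; the payoff function is kept
  separate. Payoffs are total functions on vertices, but only their values on the terminals are
  ever used.
\<close>

record 'v arena =
  graph :: "'v pair_pre_digraph"
  min_verts :: "'v set"
  max_verts :: "'v set"
  terminals :: "'v set"

locale simple_recursive_game = pair_fin_digraph "graph A"
  for A :: "'v arena" and p :: "'v \<Rightarrow> real" +
  assumes verts_partition: "pverts (graph A) = min_verts A \<union> max_verts A \<union> terminals A"
    and min_max_disjoint: "min_verts A \<inter> max_verts A = {}"
    and min_terminals_disjoint: "min_verts A \<inter> terminals A = {}"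
    and max_terminals_disjoint: "max_verts A \<inter> terminals A = {}"
    and nonterminal_has_arc: "v \<in> min_verts A \<union> max_verts A \<Longrightarrow> \<exists>w. (v, w) \<in> parcs (graph A)"
    and payoff_inj: "inj_on p (terminals A)"
    and enough_arcs: "card (terminals A) \<le> card (parcs (graph A))"

text \<open>
  A general strategy maps the history of the play, a nonempty list ending in the current vertex, to
  the next vertex. The set \<open>W\<close> consists of the vertices of the player in question. As there are no
  parallel arcs, choosing an outgoing arc is choosing its head.
\<close>

definition strategy :: "'v arena \<Rightarrow> 'v set \<Rightarrow> ('v list \<Rightarrow> 'v) \<Rightarrow> bool" where
  "strategy A W s \<longleftrightarrow> (\<forall>h. h \<noteq> [] \<longrightarrow> last h \<in> W \<longrightarrow> (last h, s h) \<in> parcs (graph A))"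

definition positional_strategy :: "'v arena \<Rightarrow> 'v set \<Rightarrow> ('v \<Rightarrow> 'v) \<Rightarrow> bool" where
  "positional_strategy A W f \<longleftrightarrow> (\<forall>v\<in>W. (v, f v) \<in> parcs (graph A))"

definition of_positional :: "('v \<Rightarrow> 'v) \<Rightarrow> 'v list \<Rightarrow> 'v" where
  "of_positional f h = f (last h)"

text \<open>
  The history after \<open>k\<close> moves, when Max plays \<open>s\<close> and Min plays \<open>t\<close> from \<open>v\<close>; it no longer changes
  once a terminal has been reached.
\<close>

primrec history :: "'v arena \<Rightarrow> ('v list \<Rightarrow> 'v) \<Rightarrow> ('v list \<Rightarrow> 'v) \<Rightarrow> 'v \<Rightarrow> nat \<Rightarrow> 'v list" where
  "history A s t v 0 = [v]"
| "history A s t v (Suc k) =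
    (let h = history A s t v k in
       if last h \<in> max_verts A then h @ [s h]
       else if last h \<in> min_verts A then h @ [t h]
       else h)"

definition payoff ::
    "'v arena \<Rightarrow> ('v \<Rightarrow> real) \<Rightarrow> ('v list \<Rightarrow> 'v) \<Rightarrow> ('v list \<Rightarrow> 'v) \<Rightarrow> 'v \<Rightarrow> real" where
  "payoff A p s t v =
    (if \<exists>k. last (history A s t v k) \<in> terminals A
     then p (last (history A s t v (LEAST k. last (history A s t v k) \<in> terminals A)))
     else 0)"

definition max_ensures ::
    "'v arena \<Rightarrow> ('v \<Rightarrow> real) \<Rightarrow> ('v \<Rightarrow> 'v) \<Rightarrow> 'v \<Rightarrow> real \<Rightarrow> bool" where
  "max_ensures A p f v x \<longleftrightarrow>
    (\<forall>t. strategy A (min_verts A) t \<longrightarrow> x \<le> payoff A p (of_positional f) t v)"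

definition min_ensures ::
    "'v arena \<Rightarrow> ('v \<Rightarrow> real) \<Rightarrow> ('v \<Rightarrow> 'v) \<Rightarrow> 'v \<Rightarrow> real \<Rightarrow> bool" where
  "min_ensures A p g v x \<longleftrightarrow>
    (\<forall>s. strategy A (max_verts A) s \<longrightarrow> payoff A p s (of_positional g) v \<le> x)"

definition Val :: "'v arena \<Rightarrow> ('v \<Rightarrow> real) \<Rightarrow> 'v \<Rightarrow> real" where
  "Val A p v = (THE x.
    (\<exists>f. positional_strategy A (max_verts A) f \<and> max_ensures A p f v x) \<and>
    (\<exists>g. positional_strategy A (min_verts A) g \<and> min_ensures A p g v x))"


section \<open>Strong solutions\<close>

text \<open>
  Symbolic names for numbers: they serve both as the operands of comparisons and as the values
  an algorithm outputs.
\<close>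

datatype 'v number = Zero | Payoff 'v

primrec number_value :: "('v \<Rightarrow> real) \<Rightarrow> 'v number \<Rightarrow> real" where
  "number_value p Zero = 0"
| "number_value p (Payoff t) = p t"

definition numbers :: "'v arena \<Rightarrow> 'v number set" where
  "numbers A = insert Zero (Payoff ` terminals A)"

record 'v solution =
  vals :: "'v \<Rightarrow> 'v number"
  max_strat :: "'v \<Rightarrow> 'v"
  min_strat :: "'v \<Rightarrow> 'v"

definition strong_solution :: "'v arena \<Rightarrow> ('v \<Rightarrow> real) \<Rightarrow> 'v solution \<Rightarrow> bool" where
  "strong_solution A p S \<longleftrightarrow>
    (\<forall>v\<in>pverts (graph A). vals S v \<in> numbers A \<and> number_value p (vals S v) = Val A p v) \<and>
    positional_strategy A (max_verts A) (max_strat S) \<and>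
    (\<forall>v\<in>pverts (graph A). max_ensures A p (max_strat S) v (Val A p v)) \<and>
    positional_strategy A (min_verts A) (min_strat S) \<and>
    (\<forall>v\<in>pverts (graph A). min_ensures A p (min_strat S) v (Val A p v))"


section \<open>Comparison-based algorithms\<close>

text \<open>
  A comparison has three possible outcomes; the subtrees of \<open>Compare a b\<close> are for
  less, equal and greater, in this order.
\<close>

datatype (operands: 'q, outputs: 'r) comparison_tree =
    Output 'r
  | Compare 'q 'q "('q, 'r) comparison_tree" "('q, 'r) comparison_tree" "('q, 'r) comparison_tree"

primrec result :: "('q \<Rightarrow> real) \<Rightarrow> ('q, 'r) comparison_tree \<Rightarrow> 'r" where
  "result e (Output r) = r"
| "result e (Compare a b l m g) =
    (if e a < e b then result e l else if e a = e b then result e m else result e g)"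

primrec num_comparisons :: "('q \<Rightarrow> real) \<Rightarrow> ('q, 'r) comparison_tree \<Rightarrow> nat" where
  "num_comparisons e (Output r) = 0"
| "num_comparisons e (Compare a b l m g) =
    Suc (if e a < e b then num_comparisons e l
         else if e a = e b then num_comparisons e m else num_comparisons e g)"

text \<open>
  Full knowledge of the graph means that the comparison tree may depend on the arena in an
  arbitrary way. Every finite graph has an isomorphic copy whose vertices are natural numbers.
\<close>

type_synonym comparison_algorithm = "nat arena \<Rightarrow> (nat number, nat solution) comparison_tree"

definition games :: "nat \<Rightarrow> (nat arena \<times> (nat \<Rightarrow> real)) set" where
  "games n = {(A, p). simple_recursive_game A p \<and> card (terminals A) = n}"

definition strongly_solves :: "nat \<Rightarrow> comparison_algorithm \<Rightarrow> bool" where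
  "strongly_solves n alg \<longleftrightarrow>
    (\<forall>(A, p)\<in>games n. operands (alg A) \<subseteq> numbers A \<and>
       strong_solution A p (result (number_value p) (alg A)))"

definition worst_case :: "nat \<Rightarrow> comparison_algorithm \<Rightarrow> enat" where
  "worst_case n alg = (SUP (A, p)\<in>games n. enat (num_comparisons (number_value p) (alg A)))"

text \<open>
  The infimum is a minimum, as \<open>enat\<close> is well-ordered; it is \<open>\<infinity>\<close> if no algorithm solves all games
  or if all of them need unboundedly many comparisons as the graph grows.
\<close>

definition comparison_complexity :: "nat \<Rightarrow> enat" where
  "comparison_complexity n = (INF alg\<in>{alg. strongly_solves n alg}. worst_case n alg)"

end

theory Submission
  imports Defs "HOL-Combinatorics.Permutations"
begin

text \<open>
  Upper bound: whether a triple of values and positional strategies is a strong solution depends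
  only on the order of \<open>0\<close> and the payoffs, so it suffices to sort these \<open>n + 1\<close> numbers by merge
  sort and to output some strong solution for that order. Strong solutions exist because value
  iteration reaches the values after finitely many rounds.

  Lower bound: in the game with one vertex of Max for each pair of terminals, the values reveal the
  order of the payoffs. A ternary tree of depth \<open>c\<close> has at most \<open>3 ^ c\<close> outputs, so \<open>n! \<le> 3 ^ c\<close>.
\<close>

section \<open>Payoffs as symbolic numbers\<close>

text \<open>Infinite play pays \<open>0\<close>, so a strategy that merely keeps the value constant
  may circle forever and forfeit a positive value; this is why value certificates carry a rank
  besides the values. Injectivity of \<open>p\<close> still allows one terminal of payoff
  \<open>0\<close>, tied with \<open>Zero\<close>. Sorting breaks this tie arbitrarily, so the order
  that is read off may be strictly finer than the true one, and transfer between payoff functions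
  must tolerate that. Only comparisons are charged. The solution at a leaf is picked from the arena
  and the sorted list for free, hence the upper bound does not depend on the size of the graph. The
  lower bound varies the payoffs on a single arena, because an algorithm may use a different tree
  for each arena.\<close>

definition outcome ::
    "'v arena \<Rightarrow> ('v list \<Rightarrow> 'v) \<Rightarrow> ('v list \<Rightarrow> 'v) \<Rightarrow> 'v \<Rightarrow> 'v number" where
  "outcome A s t v =
    (if \<exists>k. last (history A s t v k) \<in> terminals A
     then Payoff (last (history A s t v (LEAST k. last (history A s t v k) \<in> terminals A)))
     else Zero)"

text \<open>\<open>outcome\<close> does not involve \<open>p\<close>. For fixed strategies every
  guarantee thus compares two elements of \<open>numbers A\<close>, which is what carries solutions
  from one payoff function to another.\<close>

lemma payoff_eq_outcome: "payoff A p s t v = number_value p (outcome A s t v)"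
  by (simp add: payoff_def outcome_def)

lemma outcome_in_numbers: "outcome A s t v \<in> numbers A"
proof (cases "\<exists>k. last (history A s t v k) \<in> terminals A")
  case True
  then have "last (history A s t v (LEAST k. last (history A s t v k) \<in> terminals A)) \<in> terminals A"
    by (rule LeastI_ex)
  with True show ?thesis
    by (auto simp: outcome_def numbers_def)
qed (simp add: outcome_def numbers_def)

lemma strategy_of_positional:
  "positional_strategy A W f \<Longrightarrow> strategy A W (of_positional f)"
  by (auto simp: positional_strategy_def strategy_def of_positional_def)

text \<open>\<open>Val\<close> is a definite description, so uniqueness is the point: playing the
  Max strategy of each candidate value against the Min strategy of the other gives both
  inequalities.\<close>

lemma Val_eqI:
  assumes f: "positional_strategy A (max_verts A) f" "max_ensures A p f v x"
    and g: "positional_strategy A (min_verts A) g" "min_ensures A p g v x"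
  shows "Val A p v = x"
  unfolding Val_def
proof (rule the_equality)
  fix y
  assume "(\<exists>f. positional_strategy A (max_verts A) f \<and> max_ensures A p f v y) \<and>
    (\<exists>g. positional_strategy A (min_verts A) g \<and> min_ensures A p g v y)"
  then obtain f' g' where f': "positional_strategy A (max_verts A) f'" "max_ensures A p f' v y"
    and g': "positional_strategy A (min_verts A) g'" "min_ensures A p g' v y"
    by auto
  have "x \<le> payoff A p (of_positional f) (of_positional g') v"
    using f g' strategy_of_positional unfolding max_ensures_def by blast
  also have "\<dots> \<le> y"
    using f g' strategy_of_positional unfolding min_ensures_def by blast
  finally have "x \<le> y" .
  have "y \<le> payoff A p (of_positional f') (of_positional g) v"
    using f' g strategy_of_positional unfolding max_ensures_def by blast
  also have "\<dots> \<le> x"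
    using f' g strategy_of_positional unfolding min_ensures_def by blast
  finally show "y = x" using \<open>x \<le> y\<close> by simp
qed (use assms in auto)

text \<open>
  Weak monotonicity suffices: a strong solution for a payoff function that breaks the tie between
  \<open>0\<close> and a terminal of payoff \<open>0\<close> stays valid for the tied payoffs.
\<close>

lemma strong_solution_transfer:
  assumes S: "strong_solution A q S"
    and mono: "\<And>a b. a \<in> numbers A \<Longrightarrow> b \<in> numbers A \<Longrightarrow>
      number_value q a \<le> number_value q b \<Longrightarrow> number_value p a \<le> number_value p b"
  shows "strong_solution A p S"
proof -
  have pos: "positional_strategy A (max_verts A) (max_strat S)"
    "positional_strategy A (min_verts A) (min_strat S)"
    using S by (auto simp: strong_solution_def)
  have *: "max_ensures A p (max_strat S) v (number_value p (vals S v))"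
    "min_ensures A p (min_strat S) v (number_value p (vals S v))"
    if v: "v \<in> pverts (graph A)" for v
  proof -
    have "vals S v \<in> numbers A"
      "max_ensures A q (max_strat S) v (number_value q (vals S v))"
      "min_ensures A q (min_strat S) v (number_value q (vals S v))"
      using S v by (auto simp: strong_solution_def)
    then show "max_ensures A p (max_strat S) v (number_value p (vals S v))"
      "min_ensures A p (min_strat S) v (number_value p (vals S v))"
      by (auto simp: max_ensures_def min_ensures_def payoff_eq_outcome intro!: mono outcome_in_numbers)
  qed
  then have "Val A p v = number_value p (vals S v)" if "v \<in> pverts (graph A)" for v
    using that pos * by (intro Val_eqI) auto
  then show ?thesis
    using S * by (simp add: strong_solution_def)
qed


section \<open>Duality\<close>

text \<open>Swapping the players, together with negating the payoffs, turns statements about Max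
  into statements about Min.\<close>

definition dual :: "'v arena \<Rightarrow> 'v arena" where
  "dual A = A\<lparr>min_verts := max_verts A, max_verts := min_verts A\<rparr>"

lemma dual_simps [simp]:
  "graph (dual A) = graph A" "terminals (dual A) = terminals A"
  "min_verts (dual A) = max_verts A" "max_verts (dual A) = min_verts A"
  by (simp_all add: dual_def)

lemma positional_strategy_dual [simp]:
  "positional_strategy (dual A) W f = positional_strategy A W f"
  by (simp add: positional_strategy_def)

lemma strategy_dual [simp]: "strategy (dual A) W s = strategy A W s"
  by (simp add: strategy_def)

lemma (in simple_recursive_game) dual_game:
  "simple_recursive_game (dual A) (\<lambda>v. - p v)"
proof (intro simple_recursive_game.intro simple_recursive_game_axioms.intro)
  show "pair_fin_digraph (graph (dual A))"
    by (simp add: pair_fin_digraph_axioms)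
  show "pverts (graph (dual A)) =
      min_verts (dual A) \<union> max_verts (dual A) \<union> terminals (dual A)"
    unfolding dual_simps verts_partition by blast
  show "inj_on (\<lambda>v. - p v) (terminals (dual A))"
    using payoff_inj by (simp add: inj_on_def)
  show "min_verts (dual A) \<inter> max_verts (dual A) = {}"
    using min_max_disjoint by (simp add: Int_commute)
  show "\<exists>w. (v, w) \<in> parcs (graph (dual A))"
    if "v \<in> min_verts (dual A) \<union> max_verts (dual A)" for v
    using that nonterminal_has_arc[of v] by auto
qed (simp_all add: min_terminals_disjoint max_terminals_disjoint enough_arcs)

text \<open>\<open>history\<close> tests for a vertex of Max first, and dualising reverses the order
  of the two tests; disjointness makes the order immaterial.\<close>

lemma history_dual:
  assumes "min_verts A \<inter> max_verts A = {}"
  shows "history (dual A) t s v k = history A s t v k"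
proof (induction k)
  case (Suc k)
  then show ?case using assms by (auto simp: Let_def)
qed simp

lemma payoff_dual:
  assumes "min_verts A \<inter> max_verts A = {}"
  shows "payoff (dual A) (\<lambda>v. - p v) t s v = - payoff A p s t v"
  by (simp add: payoff_def history_dual[OF assms])

lemma max_ensures_dual:
  assumes "min_verts A \<inter> max_verts A = {}"
  shows "max_ensures (dual A) (\<lambda>v. - p v) g v (- x) \<longleftrightarrow> min_ensures A p g v x"
  by (simp add: max_ensures_def min_ensures_def payoff_dual[OF assms])


section \<open>Existence of strong solutions\<close>

text \<open>
  The rank witnesses that the player who profits from a nonzero value makes progress: as long as the
  value stays the same, the rank decreases, so that a terminal is reached.
\<close>

definition value_certificate ::
    "'v arena \<Rightarrow> ('v \<Rightarrow> real) \<Rightarrow> ('v \<Rightarrow> real) \<Rightarrow> ('v \<Rightarrow> nat) \<Rightarrow> bool" where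
  "value_certificate A p val r \<longleftrightarrow>
    (\<forall>t\<in>terminals A. val t = p t) \<and>
    (\<forall>v\<in>max_verts A.
      (\<forall>w. (v, w) \<in> parcs (graph A) \<longrightarrow> val w \<le> val v) \<and>
      (\<exists>w. (v, w) \<in> parcs (graph A) \<and> val w = val v \<and> (0 < val v \<longrightarrow> r w < r v)) \<and>
      (val v < 0 \<longrightarrow> (\<forall>w. (v, w) \<in> parcs (graph A) \<longrightarrow> val w = val v \<longrightarrow> r w < r v))) \<and>
    (\<forall>v\<in>min_verts A.
      (\<forall>w. (v, w) \<in> parcs (graph A) \<longrightarrow> val v \<le> val w) \<and>
      (\<exists>w. (v, w) \<in> parcs (graph A) \<and> val w = val v \<and> (val v < 0 \<longrightarrow> r w < r v)) \<and>
      (0 < val v \<longrightarrow> (\<forall>w. (v, w) \<in> parcs (graph A) \<longrightarrow> val w = val v \<longrightarrow> r w < r v)))"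

lemma value_certificate_dual:
  "value_certificate A p val r \<Longrightarrow> value_certificate (dual A) (\<lambda>v. - p v) (\<lambda>v. - val v) r"
  by (simp add: value_certificate_def)

lemma history_nonempty: "history A s t v k \<noteq> []"
  by (induction k) (auto simp: Let_def)

lemma last_history_Suc:
  "last (history A s t v (Suc k)) =
    (let h = history A s t v k in
       if last h \<in> max_verts A then s h else if last h \<in> min_verts A then t h else last h)"
  by (simp add: Let_def)

text \<open>Max moves to a successor of equal value, and of smaller rank if the value is positive.
  The value never drops along the play, so a terminal that is reached pays enough. A play that never
  ends pays \<open>0\<close>, so it must be excluded when the value is positive.\<close>

lemma (in simple_recursive_game) max_ensures_certificate:
  assumes cert: "value_certificate A p val r"
  shows "\<exists>f. positional_strategy A (max_verts A) f \<and>
    (\<forall>v\<in>pverts (graph A). max_ensures A p f v (val v))"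
proof -
  have "\<forall>v\<in>max_verts A. \<exists>w. (v, w) \<in> parcs (graph A) \<and> val w = val v \<and> (0 < val v \<longrightarrow> r w < r v)"
    using cert by (simp add: value_certificate_def)
  then obtain f where f: "\<And>v. v \<in> max_verts A \<Longrightarrow> (v, f v) \<in> parcs (graph A)"
    "\<And>v. v \<in> max_verts A \<Longrightarrow> val (f v) = val v"
    "\<And>v. v \<in> max_verts A \<Longrightarrow> 0 < val v \<Longrightarrow> r (f v) < r v"
    by metis
  have pos: "positional_strategy A (max_verts A) f"
    using f(1) by (simp add: positional_strategy_def)
  have "val v \<le> payoff A p (of_positional f) t v"
    if v: "v \<in> pverts (graph A)" and t: "strategy A (min_verts A) t" for v t
  proof -
    define u where "u k = last (history A (of_positional f) t v k)" for k
    have step: "u (Suc k) = f (u k)" if "u k \<in> max_verts A" for k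
      using that last_history_Suc[of A "of_positional f" t v k]
      by (simp add: u_def Let_def of_positional_def del: history.simps)
    have min_step: "(u k, u (Suc k)) \<in> parcs (graph A)" if "u k \<in> min_verts A" for k
    proof -
      have "u k \<notin> max_verts A" using that min_max_disjoint by auto
      then have "u (Suc k) = t (history A (of_positional f) t v k)"
        using that last_history_Suc[of A "of_positional f" t v k]
        by (simp add: u_def Let_def del: history.simps)
      then show ?thesis
        using t that history_nonempty unfolding strategy_def u_def by metis
    qed
    have stay: "u (Suc k) = u k" if "u k \<notin> max_verts A" "u k \<notin> min_verts A" for k
      using that last_history_Suc[of A "of_positional f" t v k]
      by (simp add: u_def Let_def del: history.simps)
    have arc: "(u k, u (Suc k)) \<in> parcs (graph A)" if "u k \<in> max_verts A \<union> min_verts A" for k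
      using that step min_step f(1) by auto
    have u_V: "u k \<in> pverts (graph A)" for k
    proof (induction k)
      case 0
      then show ?case using v by (simp add: u_def)
    next
      case (Suc k)
      then show ?case
        using arc[of k] stay[of k] arc_snd_in_verts[of "(u k, u (Suc k))"]
        by (cases "u k \<in> max_verts A \<union> min_verts A") auto
    qed
    have mono: "val (u k) \<le> val (u (Suc k))" for k
    proof -
      consider "u k \<in> max_verts A" | "u k \<in> min_verts A" | "u k \<notin> max_verts A" "u k \<notin> min_verts A"
        by blast
      then show ?thesis
      proof cases
        case 1
        then show ?thesis using step f(2) by simp
      next
        case 2
        then show ?thesis using min_step[of k] cert by (simp add: value_certificate_def)
      qed (simp add: stay)
    qed
    then have ge: "val v \<le> val (u k)" for k
      using lift_Suc_mono_le[of "\<lambda>k. val (u k)" 0 k] by (simp add: u_def)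
    show ?thesis
    proof (cases "\<exists>k. u k \<in> terminals A")
      case True
      then have T: "u (LEAST k. u k \<in> terminals A) \<in> terminals A" by (rule LeastI_ex)
      have "payoff A p (of_positional f) t v = p (u (LEAST k. u k \<in> terminals A))"
        using True by (simp add: payoff_def u_def)
      also have "\<dots> = val (u (LEAST k. u k \<in> terminals A))"
        using cert T by (simp add: value_certificate_def)
      finally show ?thesis using ge by simp
    next
      case False
      then have nonterm: "u k \<in> max_verts A \<union> min_verts A" for k
        using u_V[of k] verts_partition by auto
      have "val v \<le> 0"
      proof (rule ccontr)
        assume "\<not> val v \<le> 0"
        then have gt: "0 < val (u k)" for k using ge[of k] by linarith
        \<comment> \<open>Lexicographic progress: the value rises, or it stays and the rank falls.
          As a transitive irreflexive relation it forbids revisiting a vertex, which finiteness of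
          the graph makes impossible for an endless play.\<close>
        define R where "R = {(x, y). val y < val x \<or> val x = val y \<and> r x < r y}"
        have R_step: "(u (Suc k), u k) \<in> R" for k
        proof (cases "u k \<in> max_verts A")
          case True
          then show ?thesis using step[of k] f(2)[of "u k"] f(3)[of "u k"] gt[of k]
            by (simp add: R_def)
        next
          case False
          then have m: "u k \<in> min_verts A" using nonterm[of k] by auto
          show ?thesis
          proof (cases "val (u (Suc k)) = val (u k)")
            case True
            \<comment> \<open>Min's move is arbitrary, so this uses the clause that at a positive
              value every value-preserving arc from a vertex of Min lowers the rank.\<close>
            then show ?thesis using m min_step[OF m] gt[of k] cert
              by (simp add: R_def value_certificate_def)
          next
            case False
            then show ?thesis using mono[of k] by (simp add: R_def)
          qed
        qed
        have "trans R" by (auto simp: R_def trans_def)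
        have R_less: "i < j \<Longrightarrow> (u j, u i) \<in> R" for i j
        proof (induction j)
          case (Suc j)
          then show ?case using R_step \<open>trans R\<close> by (metis less_Suc_eq transE)
        qed simp
        have "u i \<noteq> u j" if "i < j" for i j
          using R_less[OF that] by (auto simp: R_def)
        then have "inj u" by (metis injI nat_neq_iff)
        moreover have "finite (range u)"
          by (rule finite_subset[OF _ pair_finite_verts]) (use u_V in blast)
        ultimately show False
          by (simp add: finite_image_iff)
      qed
      moreover have "payoff A p (of_positional f) t v = 0"
        using False by (simp add: payoff_def u_def)
      ultimately show ?thesis by simp
    qed
  qed
  then show ?thesis
    using pos by (auto simp: max_ensures_def)
qed

text \<open>
  Value iteration starts with \<open>0\<close> at the non-terminals. From then on positive values only increase
  and negative values only decrease, and all values are taken from a finite set, so the iteration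
  becomes constant. The rank of a vertex is the first round in which its final value appears.
\<close>

lemma eventually_constant_if_increasing:
  fixes x :: "nat \<Rightarrow> real"
  assumes incr: "\<And>k. 0 < x k \<Longrightarrow> x k \<le> x (Suc k)" and fin: "finite (range x)"
    and pos: "0 < x m"
  shows "\<exists>N. \<forall>k\<ge>N. x k = x N"
proof -
  have mono: "x i \<le> x k" if "i \<le> k" "0 < x i" for i k
    using that
  proof (induction k rule: dec_induct)
    case (step k)
    then show ?case using incr[of k] by linarith
  qed simp
  have fin': "finite (x ` {m..})"
    using fin by (rule rev_finite_subset) auto
  then have "Max (x ` {m..}) \<in> x ` {m..}"
    by (intro Max_in) auto
  \<comment> \<open>At \<open>N\<close> the tail attains its maximum; afterwards the sequence can
    neither drop nor exceed it.\<close>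
  then obtain N where N: "m \<le> N" "x N = Max (x ` {m..})"
    by auto
  have "0 < x N" using mono[of m N] N(1) pos by linarith
  then have "x k = x N" if "N \<le> k" for k
    using mono[of N k] that N Max_ge[OF fin', of "x k"] by force
  then show ?thesis by blast
qed

text \<open>Once the sequence leaves \<open>0\<close> it keeps its sign and is monotone; otherwise
  it is identically \<open>0\<close>.\<close>

lemma eventually_constant:
  fixes x :: "nat \<Rightarrow> real"
  assumes incr: "\<And>k. 0 < x k \<Longrightarrow> x k \<le> x (Suc k)"
    and decr: "\<And>k. x k < 0 \<Longrightarrow> x (Suc k) \<le> x k"
    and fin: "finite (range x)"
  shows "\<exists>N. \<forall>k\<ge>N. x k = x N"
proof -
  consider m where "0 < x m" | m where "x m < 0" | "\<And>k. x k = 0"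
    by (meson linorder_neqE_linordered_idom)
  then show ?thesis
  proof cases
    case 1
    then show ?thesis using eventually_constant_if_increasing[of x] incr fin by blast
  next
    case 2
    have "range (\<lambda>k. - x k) = uminus ` range x" by auto
    with fin have "finite (range (\<lambda>k. - x k))" by simp
    then show ?thesis
      using eventually_constant_if_increasing[of "\<lambda>k. - x k" m] decr 2 by simp
  qed simp
qed

section \<open>Value iteration and its stabilisation\<close>

definition succs :: "'v arena \<Rightarrow> 'v \<Rightarrow> 'v set" where
  "succs A v = {w. (v, w) \<in> parcs (graph A)}"

text \<open>On vertices, this is the value of the game stopped after \<open>k\<close> moves, where
  an unfinished play pays \<open>0\<close> just as an infinite one does.\<close>

primrec value_iter :: "'v arena \<Rightarrow> ('v \<Rightarrow> real) \<Rightarrow> nat \<Rightarrow> 'v \<Rightarrow> real" where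
  "value_iter A p 0 v = (if v \<in> terminals A then p v else 0)"
| "value_iter A p (Suc k) v =
    (if v \<in> max_verts A then Max (value_iter A p k ` succs A v)
     else if v \<in> min_verts A then Min (value_iter A p k ` succs A v)
     else if v \<in> terminals A then p v else 0)"

lemma succs_dual [simp]: "succs (dual A) v = succs A v"
  by (simp add: succs_def)

context simple_recursive_game
begin

lemma finite_succs: "finite (succs A v)"
proof (rule finite_subset)
  show "succs A v \<subseteq> snd ` parcs (graph A)" by (force simp: succs_def)
qed (simp add: pair_finite_arcs)

lemma succs_nonempty: "v \<in> max_verts A \<or> v \<in> min_verts A \<Longrightarrow> succs A v \<noteq> {}"
  using nonterminal_has_arc[of v] by (auto simp: succs_def)

lemma succs_in_verts: "w \<in> succs A v \<Longrightarrow> w \<in> pverts (graph A)"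
  using arc_snd_in_verts[of "(v, w)"] by (simp add: succs_def)

lemma finite_terminals: "finite (terminals A)"
  by (rule finite_subset[OF _ pair_finite_verts]) (simp add: verts_partition)

lemma value_iter_terminal: "v \<in> terminals A \<Longrightarrow> value_iter A p k v = p v"
  using max_terminals_disjoint min_terminals_disjoint by (cases k) auto

lemma value_iter_max:
  assumes "v \<in> max_verts A"
  shows "w \<in> succs A v \<Longrightarrow> value_iter A p k w \<le> value_iter A p (Suc k) v"
    and "\<exists>w\<in>succs A v. value_iter A p (Suc k) v = value_iter A p k w"
proof -
  show "w \<in> succs A v \<Longrightarrow> value_iter A p k w \<le> value_iter A p (Suc k) v"
    using assms finite_succs by simp
  have "Max (value_iter A p k ` succs A v) \<in> value_iter A p k ` succs A v"
    using assms finite_succs succs_nonempty by (intro Max_in) auto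
  then show "\<exists>w\<in>succs A v. value_iter A p (Suc k) v = value_iter A p k w"
    using assms by auto
qed

lemma value_iter_min:
  assumes "v \<in> min_verts A"
  shows "w \<in> succs A v \<Longrightarrow> value_iter A p (Suc k) v \<le> value_iter A p k w"
    and "\<exists>w\<in>succs A v. value_iter A p (Suc k) v = value_iter A p k w"
proof -
  have v: "v \<notin> max_verts A" using assms min_max_disjoint by auto
  show "w \<in> succs A v \<Longrightarrow> value_iter A p (Suc k) v \<le> value_iter A p k w"
    using assms v finite_succs by simp
  have "Min (value_iter A p k ` succs A v) \<in> value_iter A p k ` succs A v"
    using assms finite_succs succs_nonempty by (intro Min_in) auto
  then show "\<exists>w\<in>succs A v. value_iter A p (Suc k) v = value_iter A p k w"
    using assms v by auto
qed

lemma value_iter_dual: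
  "value_iter (dual A) (\<lambda>v. - p v) k v = - value_iter A p k v"
proof (induction k arbitrary: v)
  case (Suc k)
  have img: "value_iter (dual A) (\<lambda>v. - p v) k ` succs A v = uminus ` value_iter A p k ` succs A v"
    by (simp add: Suc.IH image_image)
  show ?case
  proof (cases "v \<in> max_verts A \<or> v \<in> min_verts A")
    case True
    then have *: "finite (value_iter A p k ` succs A v)" "value_iter A p k ` succs A v \<noteq> {}"
      using finite_succs succs_nonempty by auto
    show ?thesis
      using True min_max_disjoint
      by (auto simp: img minus_Max_eq_Min[OF *] minus_Min_eq_Max[OF *])
  qed simp
qed simp

text \<open>A positive value means that Max can force a good terminal within \<open>k\<close> moves,
  and allowing one more move does not take this away. At round \<open>0\<close> only terminals can
  be positive.\<close>

lemma value_iter_increasing: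
  "0 < value_iter A p k v \<Longrightarrow> value_iter A p k v \<le> value_iter A p (Suc k) v"
proof (induction k arbitrary: v)
  case 0
  then show ?case using max_terminals_disjoint min_terminals_disjoint by (auto split: if_splits)
next
  case (Suc k)
  consider "v \<in> max_verts A" | "v \<in> min_verts A" | "v \<notin> max_verts A" "v \<notin> min_verts A"
    by blast
  then show ?case
  proof cases
    case 1
    then obtain w where "w \<in> succs A v" "value_iter A p (Suc k) v = value_iter A p k w"
      using value_iter_max(2) by blast
    then show ?thesis
      using Suc.IH[of w] Suc.prems value_iter_max(1)[OF 1, of w "Suc k"] by linarith
  next
    case 2
    then obtain w where w: "w \<in> succs A v"
      "value_iter A p (Suc (Suc k)) v = value_iter A p (Suc k) w"
      using value_iter_min(2) by blast
    then show ?thesis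
      using Suc.IH[of w] Suc.prems value_iter_min(1)[OF 2, of w k] by linarith
  qed simp
qed

lemma value_iter_decreasing:
  "value_iter A p k v < 0 \<Longrightarrow> value_iter A p (Suc k) v \<le> value_iter A p k v"
  using simple_recursive_game.value_iter_increasing[OF dual_game, of k v]
  by (simp only: value_iter_dual neg_le_iff_le neg_0_less_iff_less)

lemma value_iter_in_numbers: "value_iter A p k v \<in> number_value p ` numbers A"
proof (induction k arbitrary: v)
  case 0
  then show ?case by (force simp: numbers_def)
next
  case (Suc k)
  consider "v \<in> max_verts A" | "v \<in> min_verts A" | "v \<notin> max_verts A" "v \<notin> min_verts A"
    by blast
  then show ?case
  proof cases
    case 1
    then show ?thesis using value_iter_max(2)[OF 1, of k] Suc.IH by metis
  next
    case 2
    then show ?thesis using value_iter_min(2)[OF 2, of k] Suc.IH by metis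
  next
    case 3
    then show ?thesis by (force simp: numbers_def)
  qed
qed

lemma value_iter_constant: "\<exists>N. \<forall>k\<ge>N. value_iter A p k v = value_iter A p N v"
proof (rule eventually_constant)
  have "finite (number_value p ` numbers A)"
    by (simp add: numbers_def finite_terminals)
  then show "finite (range (\<lambda>k. value_iter A p k v))"
    by (rule rev_finite_subset) (use value_iter_in_numbers in auto)
qed (fact value_iter_increasing value_iter_decreasing)+

lemma value_iter_uniformly_constant:
  "\<exists>N. \<forall>v\<in>pverts (graph A). \<forall>k\<ge>N. value_iter A p k v = value_iter A p N v"
proof -
  obtain N where N: "\<And>v k. N v \<le> k \<Longrightarrow> value_iter A p k v = value_iter A p (N v) v"
    using value_iter_constant by metis
  have "N v \<le> Max (N ` pverts (graph A))" if "v \<in> pverts (graph A)" for v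
    using that pair_finite_verts by simp
  then show ?thesis
    using N by (metis order_trans)
qed

lemma value_iter_mono:
  assumes "0 < value_iter A p j v" "j \<le> k"
  shows "value_iter A p j v \<le> value_iter A p k v"
  using assms(2,1)
proof (induction k rule: dec_induct)
  case (step k)
  then show ?case using value_iter_increasing[of k v] by linarith
qed simp

lemma value_iter_antimono:
  assumes "value_iter A p j v < 0" "j \<le> k"
  shows "value_iter A p k v \<le> value_iter A p j v"
  using assms(2,1)
proof (induction k rule: dec_induct)
  case (step k)
  then show ?case using value_iter_decreasing[of k v] by linarith
qed simp

text \<open>In the limit one more round changes nothing, which gives the optimality conditions. For
  the ranks, consider the round \<open>r v = Suc k\<close> in which \<open>v\<close> first shows its
  final value: the relevant successors showed that value in round \<open>k\<close>. A positive
  iterate never exceeds its limit and a negative one never falls below it, so it is their final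
  value too, and their rank is at most \<open>k\<close>.\<close>

lemma certificate_exists:
  "\<exists>val r. value_certificate A p val r \<and>
    (\<forall>v. val v \<in> number_value p ` numbers A)"
proof -
  from value_iter_uniformly_constant obtain N where
    "\<forall>v\<in>pverts (graph A). \<forall>k\<ge>N. value_iter A p k v = value_iter A p N v" ..
  then have N: "value_iter A p k v = value_iter A p N v" if "v \<in> pverts (graph A)" "N \<le> k" for v k
    using that by metis
  define val where "val = value_iter A p N"
  define r where "r v = (LEAST k. value_iter A p k v = val v)" for v
  have val_Suc: "value_iter A p (Suc N) v = val v" if "v \<in> pverts (graph A)" for v
    using N[OF that, of "Suc N"] by (simp add: val_def del: value_iter.simps)
  have r_le: "r v \<le> k" if "value_iter A p k v = val v" for v k
    unfolding r_def using that by (rule Least_le)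
  have r_val: "value_iter A p (r v) v = val v" for v
    unfolding r_def by (rule LeastI[where k = N]) (simp add: val_def)
  \<comment> \<open>Non-terminals start at \<open>0\<close>, so a nonzero limit cannot appear in
    round \<open>0\<close>.\<close>
  have r_pos: "\<exists>k. r v = Suc k" if "v \<in> max_verts A \<union> min_verts A" "val v \<noteq> 0" for v
    using that r_val[of v] max_terminals_disjoint min_terminals_disjoint
    by (cases "r v") (auto split: if_splits)
  \<comment> \<open>Round \<open>max k N\<close> is late enough both for monotonicity from
    \<open>k\<close> and for stability from \<open>N\<close>.\<close>
  have le_val: "value_iter A p k v \<le> val v"
    if "0 < value_iter A p k v" "v \<in> pverts (graph A)" for k v
    using value_iter_mono[OF that(1), of "max k N"] N[OF that(2), of "max k N"]
    by (simp add: val_def)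
  have ge_val: "val v \<le> value_iter A p k v"
    if "value_iter A p k v < 0" "v \<in> pverts (graph A)" for k v
    using value_iter_antimono[OF that(1), of "max k N"] N[OF that(2), of "max k N"]
    by (simp add: val_def)
  have max: "(\<forall>w. (v, w) \<in> parcs (graph A) \<longrightarrow> val w \<le> val v) \<and>
      (\<exists>w. (v, w) \<in> parcs (graph A) \<and> val w = val v \<and> (0 < val v \<longrightarrow> r w < r v)) \<and>
      (val v < 0 \<longrightarrow> (\<forall>w. (v, w) \<in> parcs (graph A) \<longrightarrow> val w = val v \<longrightarrow> r w < r v))"
    if v: "v \<in> max_verts A" for v
  proof (intro conjI)
    have vV: "v \<in> pverts (graph A)" using v verts_partition by auto
    have le: "val w \<le> val v" if "w \<in> succs A v" for w
      using value_iter_max(1)[OF v that, of N] val_Suc[OF vV] by (simp add: val_def)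
    then show "\<forall>w. (v, w) \<in> parcs (graph A) \<longrightarrow> val w \<le> val v"
      by (simp add: succs_def)
    show "\<exists>w. (v, w) \<in> parcs (graph A) \<and> val w = val v \<and> (0 < val v \<longrightarrow> r w < r v)"
    proof (cases "0 < val v")
      case True
      then obtain k where k: "r v = Suc k" using r_pos[of v] v by auto
      obtain w where w: "w \<in> succs A v" "value_iter A p k w = val v"
        using value_iter_max(2)[OF v, of k] r_val[of v] unfolding k by auto
      then have "val w = val v"
        using le_val[of k w] le[of w] True succs_in_verts[of w v] by simp
      moreover from this have "r w < r v"
        using r_le[of k w] w k by simp
      ultimately show ?thesis
        using w by (auto simp: succs_def)
    next
      case False
      then show ?thesis
        using value_iter_max(2)[OF v, of N] val_Suc[OF vV] by (auto simp: succs_def val_def)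
    qed
    show "val v < 0 \<longrightarrow> (\<forall>w. (v, w) \<in> parcs (graph A) \<longrightarrow> val w = val v \<longrightarrow> r w < r v)"
    proof (intro impI allI)
      fix w assume a: "val v < 0" "(v, w) \<in> parcs (graph A)" "val w = val v"
      then obtain k where k: "r v = Suc k" using r_pos[of v] v by auto
      have w: "w \<in> succs A v" using a by (simp add: succs_def)
      have "value_iter A p k w \<le> val v"
        using value_iter_max(1)[OF v w, of k] r_val[of v] k by simp
      then have "value_iter A p k w = val w"
        using a ge_val[of k w] succs_in_verts[OF w] by simp
      then show "r w < r v" using r_le[of k w] k by simp
    qed
  qed
  have min: "(\<forall>w. (v, w) \<in> parcs (graph A) \<longrightarrow> val v \<le> val w) \<and>
      (\<exists>w. (v, w) \<in> parcs (graph A) \<and> val w = val v \<and> (val v < 0 \<longrightarrow> r w < r v)) \<and>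
      (0 < val v \<longrightarrow> (\<forall>w. (v, w) \<in> parcs (graph A) \<longrightarrow> val w = val v \<longrightarrow> r w < r v))"
    if v: "v \<in> min_verts A" for v
  proof (intro conjI)
    have vV: "v \<in> pverts (graph A)" using v verts_partition by auto
    have le: "val v \<le> val w" if "w \<in> succs A v" for w
      using value_iter_min(1)[OF v that, of N] val_Suc[OF vV] by (simp add: val_def)
    then show "\<forall>w. (v, w) \<in> parcs (graph A) \<longrightarrow> val v \<le> val w"
      by (simp add: succs_def)
    show "\<exists>w. (v, w) \<in> parcs (graph A) \<and> val w = val v \<and> (val v < 0 \<longrightarrow> r w < r v)"
    proof (cases "val v < 0")
      case True
      then obtain k where k: "r v = Suc k" using r_pos[of v] v by auto
      obtain w where w: "w \<in> succs A v" "value_iter A p k w = val v"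
        using value_iter_min(2)[OF v, of k] r_val[of v] unfolding k by auto
      then have "val w = val v"
        using ge_val[of k w] le[of w] True succs_in_verts[of w v] by simp
      moreover from this have "r w < r v"
        using r_le[of k w] w k by simp
      ultimately show ?thesis
        using w by (auto simp: succs_def)
    next
      case False
      then show ?thesis
        using value_iter_min(2)[OF v, of N] val_Suc[OF vV] by (auto simp: succs_def val_def)
    qed
    show "0 < val v \<longrightarrow> (\<forall>w. (v, w) \<in> parcs (graph A) \<longrightarrow> val w = val v \<longrightarrow> r w < r v)"
    proof (intro impI allI)
      fix w assume a: "0 < val v" "(v, w) \<in> parcs (graph A)" "val w = val v"
      then obtain k where k: "r v = Suc k" using r_pos[of v] v by auto
      have w: "w \<in> succs A v" using a by (simp add: succs_def)
      have "val v \<le> value_iter A p k w"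
        using value_iter_min(1)[OF v w, of k] r_val[of v] k by simp
      then have "value_iter A p k w = val w"
        using a le_val[of k w] succs_in_verts[OF w] by simp
      then show "r w < r v" using r_le[of k w] k by simp
    qed
  qed
  have "\<forall>t\<in>terminals A. val t = p t"
    by (simp add: val_def value_iter_terminal)
  then have "value_certificate A p val r"
    using max min by (simp add: value_certificate_def)
  moreover have "val v \<in> number_value p ` numbers A" for v
    unfolding val_def by (rule value_iter_in_numbers)
  ultimately show ?thesis by blast
qed

lemma strong_solution_exists: "\<exists>S. strong_solution A p S"
proof -
  obtain val r where cert: "value_certificate A p val r"
    and num: "\<And>v. val v \<in> number_value p ` numbers A"
    using certificate_exists by blast
  obtain f where f: "positional_strategy A (max_verts A) f"
    "\<And>v. v \<in> pverts (graph A) \<Longrightarrow> max_ensures A p f v (val v)"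
    using max_ensures_certificate[OF cert] by blast
  \<comment> \<open>Min's strategy is Max's strategy in the dual game, whose certificate has negated
    values and the same rank.\<close>
  obtain g where g: "positional_strategy A (min_verts A) g"
    "\<And>v. v \<in> pverts (graph A) \<Longrightarrow> min_ensures A p g v (val v)"
    using simple_recursive_game.max_ensures_certificate[OF dual_game value_certificate_dual[OF cert]]
      max_ensures_dual[OF min_max_disjoint] by auto
  have "\<exists>a. a \<in> numbers A \<and> number_value p a = val v" for v
    using num[of v] by auto
  then obtain h where h: "\<And>v. h v \<in> numbers A" "\<And>v. number_value p (h v) = val v"
    by metis
  have "Val A p v = val v" if "v \<in> pverts (graph A)" for v
    using f g that by (intro Val_eqI) auto
  then have "strong_solution A p \<lparr>vals = h, max_strat = f, min_strat = g\<rparr>"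
    using f g h by (simp add: strong_solution_def)
  then show ?thesis by blast
qed

end

section \<open>Sorting with comparison trees\<close>

primrec bind_tree ::
    "('q, 'r) comparison_tree \<Rightarrow> ('r \<Rightarrow> ('q, 's) comparison_tree) \<Rightarrow> ('q, 's) comparison_tree"
  where
  "bind_tree (Output r) f = f r"
| "bind_tree (Compare a b l m g) f =
    Compare a b (bind_tree l f) (bind_tree m f) (bind_tree g f)"

lemma result_bind [simp]: "result e (bind_tree t f) = result e (f (result e t))"
  by (induction t) auto

lemma num_comparisons_bind [simp]:
  "num_comparisons e (bind_tree t f) = num_comparisons e t + num_comparisons e (f (result e t))"
  by (induction t) auto

lemma operands_bind [simp]:
  "operands (bind_tree t f) = operands t \<union> (\<Union>r\<in>outputs t. operands (f r))"
  by (induction t) auto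

lemma outputs_bind [simp]: "outputs (bind_tree t f) = (\<Union>r\<in>outputs t. outputs (f r))"
  by (induction t) auto

lemma result_in_outputs: "result e t \<in> outputs t"
  by (induction t) auto

text \<open>The outcomes less and equal are treated alike, so a tie is broken by the order of the
  arguments.\<close>

fun merge_tree :: "'q list \<Rightarrow> 'q list \<Rightarrow> ('q, 'q list) comparison_tree" where
  "merge_tree [] ys = Output ys"
| "merge_tree xs [] = Output xs"
| "merge_tree (x # xs) (y # ys) = Compare x y
    (bind_tree (merge_tree xs (y # ys)) (\<lambda>zs. Output (x # zs)))
    (bind_tree (merge_tree xs (y # ys)) (\<lambda>zs. Output (x # zs)))
    (bind_tree (merge_tree (x # xs) ys) (\<lambda>zs. Output (y # zs)))"

lemma mset_merge_tree: "zs \<in> outputs (merge_tree xs ys) \<Longrightarrow> mset zs = mset xs + mset ys"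
  by (induction xs ys arbitrary: zs rule: merge_tree.induct) auto

lemma operands_merge_tree: "operands (merge_tree xs ys) \<subseteq> set xs \<union> set ys"
  by (induction xs ys rule: merge_tree.induct) auto

lemma num_comparisons_merge_tree:
  "num_comparisons e (merge_tree xs ys) \<le> length xs + length ys"
  by (induction xs ys rule: merge_tree.induct) auto

lemma set_result_merge_tree: "set (result e (merge_tree xs ys)) = set xs \<union> set ys"
  using mset_merge_tree[OF result_in_outputs, of e xs ys] by (metis set_mset_mset set_mset_union)

lemma sorted_merge_tree:
  "sorted (map e xs) \<Longrightarrow> sorted (map e ys) \<Longrightarrow> sorted (map e (result e (merge_tree xs ys)))"
  by (induction xs ys rule: merge_tree.induct) (auto simp: set_result_merge_tree)

text \<open>The recursion depth \<open>k\<close> is explicit and the split point is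
  \<open>2 ^ k\<close>. This avoids logarithms: the list gets sorted as soon as its length is at
  most \<open>2 ^ k\<close>, and each of the \<open>k\<close> levels merges at a total cost of at
  most its length.\<close>

primrec merge_sort :: "nat \<Rightarrow> 'q list \<Rightarrow> ('q, 'q list) comparison_tree" where
  "merge_sort 0 xs = Output xs"
| "merge_sort (Suc k) xs =
    bind_tree (merge_sort k (take (2 ^ k) xs)) (\<lambda>ys.
      bind_tree (merge_sort k (drop (2 ^ k) xs)) (merge_tree ys))"

text \<open>Stated for every leaf rather than for the result of a run, because the bound on
  \<open>operands\<close> also concerns branches that no payoff function reaches.\<close>

lemma mset_merge_sort: "ys \<in> outputs (merge_sort k xs) \<Longrightarrow> mset ys = mset xs"
proof (induction k arbitrary: xs ys)
  case (Suc k)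
  then obtain as bs where "as \<in> outputs (merge_sort k (take (2 ^ k) xs))"
    "bs \<in> outputs (merge_sort k (drop (2 ^ k) xs))" "ys \<in> outputs (merge_tree as bs)"
    by auto
  then have "mset ys = mset (take (2 ^ k) xs) + mset (drop (2 ^ k) xs)"
    using Suc.IH mset_merge_tree by metis
  then show ?case by (metis append_take_drop_id mset_append)
qed simp

lemma mset_result_merge_sort: "mset (result e (merge_sort k xs)) = mset xs"
  by (rule mset_merge_sort[OF result_in_outputs])

lemma operands_merge_sort: "operands (merge_sort k xs) \<subseteq> set xs"
proof (induction k arbitrary: xs)
  case (Suc k)
  have "operands (merge_tree as bs) \<subseteq> set xs"
    if "as \<in> outputs (merge_sort k (take (2 ^ k) xs))"
      "bs \<in> outputs (merge_sort k (drop (2 ^ k) xs))" for as bs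
  proof -
    have "set as \<subseteq> set xs" "set bs \<subseteq> set xs"
      using that[THEN mset_merge_sort, THEN mset_eq_setD] set_take_subset set_drop_subset by metis+
    then show ?thesis using operands_merge_tree[of as bs] by blast
  qed
  moreover have "operands (merge_sort k (take (2 ^ k) xs)) \<subseteq> set xs"
    "operands (merge_sort k (drop (2 ^ k) xs)) \<subseteq> set xs"
    using Suc.IH set_take_subset set_drop_subset by (metis order_trans)+
  ultimately show ?case by auto
qed simp

lemma num_comparisons_merge_sort: "num_comparisons e (merge_sort k xs) \<le> k * length xs"
proof (induction k arbitrary: xs)
  case (Suc k)
  let ?as = "result e (merge_sort k (take (2 ^ k) xs))"
  let ?bs = "result e (merge_sort k (drop (2 ^ k) xs))"
  have "length ?as + length ?bs = length (take (2 ^ k) xs) + length (drop (2 ^ k) xs)"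
    using mset_result_merge_sort by (metis size_mset)
  also have "\<dots> = length xs"
    by (metis append_take_drop_id length_append)
  finally have "num_comparisons e (merge_tree ?as ?bs) \<le> length xs"
    using num_comparisons_merge_tree[of e ?as ?bs] by simp
  moreover have "num_comparisons e (merge_sort k (take (2 ^ k) xs))
      + num_comparisons e (merge_sort k (drop (2 ^ k) xs))
      \<le> k * (length (take (2 ^ k) xs) + length (drop (2 ^ k) xs))"
    unfolding distrib_left by (intro add_mono Suc.IH)
  moreover have "length (take (2 ^ k) xs) + length (drop (2 ^ k) xs) = length xs"
    by (metis append_take_drop_id length_append)
  ultimately show ?case by (simp only: merge_sort.simps num_comparisons_bind mult_Suc)
qed simp

lemma sorted_merge_sort:
  "length xs \<le> 2 ^ k \<Longrightarrow> sorted (map e (result e (merge_sort k xs)))"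
proof (induction k arbitrary: xs)
  case 0
  then show ?case by (cases xs) auto
next
  case (Suc k)
  then show ?case by (simp add: sorted_merge_tree)
qed


section \<open>The upper bound\<close>

definition position :: "'q list \<Rightarrow> 'q \<Rightarrow> nat" where
  "position ys = inv_into {..<length ys} ((!) ys)"

lemma position:
  assumes "a \<in> set ys"
  shows "position ys a < length ys" "ys ! position ys a = a"
proof -
  have a: "a \<in> (!) ys ` {..<length ys}"
    using assms by (auto simp: in_set_conv_nth)
  show "position ys a < length ys" "ys ! position ys a = a"
    unfolding position_def using inv_into_into[OF a] f_inv_into_f[OF a] by auto
qed

text \<open>A canonical payoff function for the order listed in \<open>ys\<close>, shifted so that
  \<open>Zero\<close> sits at \<open>0\<close>. It is injective on the terminals listed in
  \<open>ys\<close>, and it separates a listed terminal of payoff \<open>0\<close> from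
  \<open>Zero\<close>.\<close>

definition position_payoff :: "'v number list \<Rightarrow> 'v \<Rightarrow> real" where
  "position_payoff ys t = real (position ys (Payoff t)) - real (position ys Zero)"

lemma number_value_position_payoff:
  "number_value (position_payoff ys) a = real (position ys a) - real (position ys Zero)"
  by (cases a) (simp_all add: position_payoff_def)

lemma (in simple_recursive_game) game_with_payoff:
  assumes "inj_on q (terminals A)"
  shows "simple_recursive_game A q"
  by (intro simple_recursive_game.intro simple_recursive_game_axioms.intro pair_fin_digraph_axioms
      verts_partition min_max_disjoint min_terminals_disjoint max_terminals_disjoint
      nonterminal_has_arc enough_arcs assms)

text \<open>The chosen solution depends on \<open>A\<close> and \<open>ys\<close> only, so a leaf
  can output it without knowing \<open>p\<close>. Sortedness makes the order of positions imply the
  weak order of the true payoffs, as the transfer requires.\<close>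

lemma strong_solution_position_payoff:
  assumes game: "simple_recursive_game A p"
    and ys: "set ys = numbers A" "sorted (map (number_value p) ys)"
  shows "strong_solution A p (SOME S. strong_solution A (position_payoff ys) S)"
proof (rule strong_solution_transfer)
  interpret simple_recursive_game A p by fact
  have "inj_on (position_payoff ys) (terminals A)"
  proof (rule inj_onI)
    fix s t assume "s \<in> terminals A" "t \<in> terminals A" "position_payoff ys s = position_payoff ys t"
    then have "position ys (Payoff s) = position ys (Payoff t)"
      "Payoff s \<in> set ys" "Payoff t \<in> set ys"
      by (auto simp: position_payoff_def ys numbers_def)
    then have "Payoff s = Payoff t" by (metis position(2))
    then show "s = t" by simp
  qed
  then have "simple_recursive_game A (position_payoff ys)"
    by (rule game_with_payoff)
  then show "strong_solution A (position_payoff ys) (SOME S. strong_solution A (position_payoff ys) S)"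
    by (rule someI_ex[OF simple_recursive_game.strong_solution_exists])
  fix a b assume ab: "a \<in> numbers A" "b \<in> numbers A"
    "number_value (position_payoff ys) a \<le> number_value (position_payoff ys) b"
  then have "map (number_value p) ys ! position ys a \<le> map (number_value p) ys ! position ys b"
    using ys position(1)[of _ ys] by (intro sorted_nth_mono) (auto simp: number_value_position_payoff)
  then show "number_value p a \<le> number_value p b"
    using ab ys(1) by (simp add: position)
qed

definition sorting_algorithm :: "nat \<Rightarrow> comparison_algorithm" where
  "sorting_algorithm k A =
    bind_tree (merge_sort k (Zero # map Payoff (sorted_list_of_set (terminals A))))
      (\<lambda>ys. Output (SOME S. strong_solution A (position_payoff ys) S))"

text \<open>\<open>Zero\<close> is sorted along with the payoffs, so \<open>n + 1\<close> numbers
  must fit into \<open>2 ^ k\<close>.\<close>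

lemma sorting_algorithm:
  assumes "n < 2 ^ k"
  shows "strongly_solves n (sorting_algorithm k)"
    and "worst_case n (sorting_algorithm k) \<le> enat (k * Suc n)"
proof -
  have *: "operands (sorting_algorithm k A) \<subseteq> numbers A"
      "strong_solution A p (result (number_value p) (sorting_algorithm k A))"
      "num_comparisons (number_value p) (sorting_algorithm k A) \<le> k * Suc n"
    if "(A, p) \<in> games n" for A p
  proof -
    let ?xs = "Zero # map Payoff (sorted_list_of_set (terminals A))"
    have game: "simple_recursive_game A p" and n: "card (terminals A) = n"
      using that by (auto simp: games_def)
    interpret simple_recursive_game A p by fact
    have set: "set ?xs = numbers A" and len: "length ?xs = Suc n"
      using n finite_terminals by (simp_all add: numbers_def)
    show "operands (sorting_algorithm k A) \<subseteq> numbers A"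
      using operands_merge_sort[of k ?xs] set by (simp add: sorting_algorithm_def)
    have "set (result (number_value p) (merge_sort k ?xs)) = numbers A"
      using mset_result_merge_sort[THEN mset_eq_setD] set by metis
    moreover have "sorted (map (number_value p) (result (number_value p) (merge_sort k ?xs)))"
      by (rule sorted_merge_sort) (use len assms in linarith)
    ultimately show "strong_solution A p (result (number_value p) (sorting_algorithm k A))"
      using strong_solution_position_payoff[OF game] by (simp add: sorting_algorithm_def)
    show "num_comparisons (number_value p) (sorting_algorithm k A) \<le> k * Suc n"
      using num_comparisons_merge_sort[of "number_value p" k ?xs] len
      by (simp add: sorting_algorithm_def)
  qed
  show "strongly_solves n (sorting_algorithm k)"
    using * by (auto simp: strongly_solves_def)
  show "worst_case n (sorting_algorithm k) \<le> enat (k * Suc n)"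
    unfolding worst_case_def using * by (auto intro!: SUP_least)
qed

section \<open>The lower bound\<close>

text \<open>The first comparison splits \<open>E\<close> into three classes, each left with a budget
  of \<open>c - 1\<close>. Only runs on \<open>E\<close> are bounded; the tree itself may be deeper.
  Finiteness is carried along since \<open>card\<close> of an infinite set is
  \<open>0\<close>.\<close>

lemma card_results_le:
  assumes "\<And>e. e \<in> E \<Longrightarrow> num_comparisons e t \<le> c"
  shows "finite ((\<lambda>e. result e t) ` E) \<and> card ((\<lambda>e. result e t) ` E) \<le> 3 ^ c"
  using assms
proof (induction t arbitrary: E c)
  case (Output r)
  have "finite ((\<lambda>e. result e (Output r)) ` E)" by (rule finite_subset[of _ "{r}"]) auto
  moreover have "card ((\<lambda>e. result e (Output r)) ` E) \<le> card {r}" by (rule card_mono) auto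
  ultimately show ?case by (simp add: le_trans[OF _ one_le_power])
next
  case (Compare a b l m g)
  let ?L = "{e \<in> E. e a < e b}" and ?M = "{e \<in> E. e a = e b}" and ?G = "{e \<in> E. e b < e a}"
  let ?I = "\<lambda>t E. (\<lambda>e. result e t) ` E"
  show ?case
  proof (cases c)
    case 0
    then have "E = {}" using Compare.prems by fastforce
    then show ?thesis by simp
  next
    case (Suc d)
    have L: "finite (?I l ?L) \<and> card (?I l ?L) \<le> 3 ^ d"
      by (rule Compare.IH(1)) (use Compare.prems Suc in force)
    have M: "finite (?I m ?M) \<and> card (?I m ?M) \<le> 3 ^ d"
      by (rule Compare.IH(2)) (use Compare.prems Suc in force)
    have G: "finite (?I g ?G) \<and> card (?I g ?G) \<le> 3 ^ d"
      by (rule Compare.IH(3)) (use Compare.prems Suc in force)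
    have eq: "?I (Compare a b l m g) E \<subseteq> ?I l ?L \<union> ?I m ?M \<union> ?I g ?G"
      by (auto simp: image_iff not_less)
    have fin: "finite (?I l ?L \<union> ?I m ?M \<union> ?I g ?G)"
      using L M G by simp
    have "card (?I (Compare a b l m g) E) \<le> card (?I l ?L \<union> ?I m ?M \<union> ?I g ?G)"
      by (rule card_mono[OF fin eq])
    also have "\<dots> \<le> card (?I l ?L) + card (?I m ?M) + card (?I g ?G)"
      by (meson card_Un_le add_le_mono1 le_trans)
    also have "\<dots> \<le> 3 ^ c"
      using L M G Suc by simp
    finally show ?thesis
      using finite_subset[OF eq fin] by blast
  qed
qed

text \<open>
  Every pair \<open>(i, j)\<close> of terminals has a vertex of Max with arcs to \<open>i\<close> and \<open>j\<close>, so that the values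
  of a strong solution determine the order of the payoffs.
\<close>

definition pair_vertex :: "nat \<Rightarrow> nat \<Rightarrow> nat \<Rightarrow> nat" where
  "pair_vertex n i j = n + prod_encode (i, j)"

definition pair_arena :: "nat \<Rightarrow> nat arena" where
  "pair_arena n =
    (let M = {pair_vertex n i j | i j. i < n \<and> j < n} in
     \<lparr>graph = \<lparr>pverts = M \<union> {..<n},
        parcs = {(pair_vertex n i j, k) | i j k. i < n \<and> j < n \<and> (k = i \<or> k = j)}\<rparr>,
      min_verts = {}, max_verts = M, terminals = {..<n}\<rparr>)"

lemma pair_vertex_eq_iff [simp]:
  "pair_vertex n i j = pair_vertex n i' j' \<longleftrightarrow> i = i' \<and> j = j'"
  by (simp add: pair_vertex_def)

lemma not_pair_vertex_less [simp]: "\<not> pair_vertex n i j < n"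
  by (simp add: pair_vertex_def)

lemma pair_arena_simps [simp]:
  "terminals (pair_arena n) = {..<n}"
  "min_verts (pair_arena n) = {}"
  "max_verts (pair_arena n) = {pair_vertex n i j | i j. i < n \<and> j < n}"
  "pverts (graph (pair_arena n)) = max_verts (pair_arena n) \<union> {..<n}"
  "parcs (graph (pair_arena n)) =
    {(pair_vertex n i j, k) | i j k. i < n \<and> j < n \<and> (k = i \<or> k = j)}"
  by (simp_all add: pair_arena_def Let_def)

lemma pair_arena_game:
  assumes "inj_on p {..<n}"
  shows "simple_recursive_game (pair_arena n) p"
proof (intro simple_recursive_game.intro simple_recursive_game_axioms.intro)
  have M: "max_verts (pair_arena n) = (\<lambda>(i, j). pair_vertex n i j) ` ({..<n} \<times> {..<n})"
    by auto
  have fin_M: "finite (max_verts (pair_arena n))" unfolding M by simp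
  have fin_E: "finite (parcs (graph (pair_arena n)))"
    by (rule finite_subset[of _ "max_verts (pair_arena n) \<times> {..<n}"]) (use fin_M in auto)
  show "pair_fin_digraph (graph (pair_arena n))"
    using fin_M fin_E by unfold_locales auto
  \<comment> \<open>The diagonal vertices \<open>(i, i)\<close> supply \<open>n\<close> arcs for
    every \<open>n\<close>, even for \<open>n = 1\<close>, where there are no proper pairs.\<close>
  have "card {..<n} \<le> card (parcs (graph (pair_arena n)))"
    by (rule card_inj_on_le[where f = "\<lambda>i. (pair_vertex n i i, i)", OF _ _ fin_E])
      (auto simp: inj_on_def)
  then show "card (terminals (pair_arena n)) \<le> card (parcs (graph (pair_arena n)))"
    by simp
qed (use assms in auto)

lemma payoff_pair_arena:
  assumes v: "v \<in> max_verts (pair_arena n)" and s: "s [v] < n"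
  shows "payoff (pair_arena n) p s t v = p (s [v])"
proof -
  let ?P = "\<lambda>k. last (history (pair_arena n) s t v k) \<in> terminals (pair_arena n)"
  have 0: "\<not> ?P 0" using v by auto
  have last: "last (history (pair_arena n) s t v (Suc 0)) = s [v]" using v by simp
  then have 1: "?P (Suc 0)" using s by simp
  have "(LEAST k. ?P k) = Suc 0"
  proof (rule Least_equality)
    show "Suc 0 \<le> k" if "?P k" for k using that 0 by (cases k) auto
  qed (fact 1)
  then show ?thesis
    using 1 last unfolding payoff_def by (metis (no_types, lifting))
qed

text \<open>The strategies of \<open>S\<close> supply both bounds: Max's own move at the vertex
  leads to \<open>i\<close> or \<open>j\<close>, and Min's guarantee must withstand a deviation of
  Max to either of them.\<close>

lemma Val_pair_arena:
  assumes S: "strong_solution (pair_arena n) p S" and ij: "i < n" "j < n"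
  shows "Val (pair_arena n) p (pair_vertex n i j) = max (p i) (p j)"
proof -
  let ?A = "pair_arena n" and ?v = "pair_vertex n i j" and ?f = "max_strat S"
  have v: "?v \<in> max_verts ?A" using ij by auto
  then have V: "?v \<in> pverts (graph ?A)" by simp
  have f: "positional_strategy ?A (max_verts ?A) ?f" "max_ensures ?A p ?f ?v (Val ?A p ?v)"
    and g: "min_ensures ?A p (min_strat S) ?v (Val ?A p ?v)"
    using S V by (auto simp: strong_solution_def)
  have fv: "?f ?v = i \<or> ?f ?v = j"
    using f(1) v by (fastforce simp: positional_strategy_def)
  have "strategy ?A (min_verts ?A) t" for t by (simp add: strategy_def)
  \<comment> \<open>Min owns no vertices, so any function, even \<open>undefined\<close>, is a
    strategy of Min.\<close>
  then have "Val ?A p ?v \<le> payoff ?A p (of_positional ?f) undefined ?v"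
    using f(2) unfolding max_ensures_def by blast
  also have "\<dots> = p (?f ?v)"
    using payoff_pair_arena[OF v, of "of_positional ?f"] fv ij by (auto simp: of_positional_def)
  finally have le: "Val ?A p ?v \<le> max (p i) (p j)" using fv by auto
  have ge: "p k \<le> Val ?A p ?v" if k: "k = i \<or> k = j" for k
  proof -
    have "positional_strategy ?A (max_verts ?A) (?f(?v := k))"
      using f(1) k ij by (auto simp: positional_strategy_def)
    then have "payoff ?A p (of_positional (?f(?v := k))) (of_positional (min_strat S)) ?v \<le> Val ?A p ?v"
      using g strategy_of_positional unfolding min_ensures_def by blast
    then show ?thesis
      using payoff_pair_arena[OF v, of "of_positional (?f(?v := k))"] k ij
      by (auto simp: of_positional_def)
  qed
  show ?thesis using le ge[of i] ge[of j] by auto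
qed

text \<open>A single \<open>S\<close> serves both payoff functions. \<open>Suc\<close> keeps the
  payoffs positive, which rules out \<open>Zero\<close>; injectivity then forces \<open>S\<close> to
  name \<open>j\<close>, the larger terminal under \<sigma>, and so \<open>j\<close> attains the
  maximum under \<tau> as well.\<close>

lemma strong_solution_pair_arena_less:
  assumes S: "strong_solution (pair_arena n) (\<lambda>i. real (Suc (\<sigma> i))) S"
      "strong_solution (pair_arena n) (\<lambda>i. real (Suc (\<tau> i))) S"
    and inj: "inj \<sigma>" "inj \<tau>" and ij: "i < n" "j < n" and less: "\<sigma> i < \<sigma> j"
  shows "\<tau> i < \<tau> j"
proof -
  let ?v = "pair_vertex n i j"
  have "?v \<in> pverts (graph (pair_arena n))" using ij by auto
  then have num: "number_value (\<lambda>i. real (Suc (\<sigma> i))) (vals S ?v) = max (real (Suc (\<sigma> i))) (real (Suc (\<sigma> j)))"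
    "number_value (\<lambda>i. real (Suc (\<tau> i))) (vals S ?v) = max (real (Suc (\<tau> i))) (real (Suc (\<tau> j)))"
    using S Val_pair_arena[OF S(1) ij] Val_pair_arena[OF S(2) ij]
    by (simp_all add: strong_solution_def)
  have "vals S ?v = Payoff j"
  proof (cases "vals S ?v")
    case Zero
    then show ?thesis using num(1) by simp
  next
    case (Payoff k)
    then have "\<sigma> k = \<sigma> j" using num(1) less by simp
    then show ?thesis using inj(1) Payoff by (simp add: inj_eq)
  qed
  then have "\<tau> i \<le> \<tau> j" using num(2) by simp
  moreover have "\<tau> i \<noteq> \<tau> j" using inj(2) less by (auto simp: inj_eq)
  ultimately show ?thesis by simp
qed

text \<open>Recovers a permutation from the order it induces: \<sigma> maps the counted set onto
  \<open>{..<\<sigma> i}\<close>.\<close>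

lemma permutes_lessThan_rank:
  assumes "\<sigma> permutes {..<n::nat}" "i < n"
  shows "card {j. j < n \<and> \<sigma> j < \<sigma> i} = \<sigma> i"
proof -
  have less: "\<sigma> i < n" using permutes_in_image[OF assms(1), of i] assms(2) by simp
  have img: "\<sigma> ` {..<n} = {..<n}" by (rule permutes_image[OF assms(1)])
  have "\<sigma> ` {j. j < n \<and> \<sigma> j < \<sigma> i} = \<sigma> ` {..<n} \<inter> {..<\<sigma> i}"
    by auto
  also have "\<dots> = {..<\<sigma> i}"
    unfolding img using less by auto
  finally have "card (\<sigma> ` {j. j < n \<and> \<sigma> j < \<sigma> i}) = \<sigma> i"
    by simp
  moreover have "inj_on \<sigma> {j. j < n \<and> \<sigma> j < \<sigma> i}"
    by (rule inj_on_subset[OF permutes_inj[OF assms(1)] subset_UNIV])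
  ultimately show ?thesis
    by (simp add: card_image)
qed

lemma fact_le_power_worst_case:
  assumes solves: "strongly_solves n alg" and worst: "worst_case n alg \<le> enat c"
  shows "fact n \<le> (3::nat) ^ c"
proof -
  let ?P = "{\<sigma>. \<sigma> permutes {..<n}}"
  let ?e = "\<lambda>\<sigma> i. real (Suc (\<sigma> i))"
  let ?t = "alg (pair_arena n)"
  let ?E = "(\<lambda>\<sigma>. number_value (?e \<sigma>)) ` ?P"
  let ?R = "\<lambda>\<sigma>. result (number_value (?e \<sigma>)) ?t"
  have inj: "inj \<sigma>" if "\<sigma> \<in> ?P" for \<sigma> using that permutes_inj by auto
  have game: "(pair_arena n, ?e \<sigma>) \<in> games n" if "\<sigma> \<in> ?P" for \<sigma>
  proof -
    have "inj_on (?e \<sigma>) {..<n}"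
      by (rule inj_onI) (simp add: inj_eq[OF inj[OF that]])
    then show ?thesis
      by (simp add: games_def pair_arena_game)
  qed
  then have sol: "strong_solution (pair_arena n) (?e \<sigma>) (?R \<sigma>)" if "\<sigma> \<in> ?P" for \<sigma>
    using solves that by (auto simp: strongly_solves_def)
  have "enat (num_comparisons (number_value (?e \<sigma>)) ?t) \<le> worst_case n alg" if "\<sigma> \<in> ?P" for \<sigma>
    using SUP_upper[OF game[OF that],
        of "\<lambda>(A, p). enat (num_comparisons (number_value p) (alg A))"]
    by (simp add: worst_case_def)
  from order_trans[OF this worst]
  have num: "num_comparisons e ?t \<le> c" if "e \<in> ?E" for e
    using that by auto
  \<comment> \<open>Equal outputs induce equal orders on the terminals, hence equal
    permutations.\<close>
  have "inj_on ?R ?P"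
  proof (rule inj_onI)
    fix \<sigma> \<tau> assume P: "\<sigma> \<in> ?P" "\<tau> \<in> ?P" and eq: "?R \<sigma> = ?R \<tau>"
    have "\<sigma> j < \<sigma> i \<longleftrightarrow> \<tau> j < \<tau> i" if "i < n" "j < n" for i j
      using strong_solution_pair_arena_less[OF sol[OF P(1)] _ inj[OF P(1)] inj[OF P(2)] that(2,1)]
        strong_solution_pair_arena_less[OF sol[OF P(2)] _ inj[OF P(2)] inj[OF P(1)] that(2,1)]
        sol[OF P(1)] sol[OF P(2)] eq by auto
    then have "{j. j < n \<and> \<sigma> j < \<sigma> i} = {j. j < n \<and> \<tau> j < \<tau> i}" if "i < n" for i
      using that by auto
    then have "\<sigma> i = \<tau> i" if "i < n" for i
      using P permutes_lessThan_rank that by (metis mem_Collect_eq)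
    moreover have "\<sigma> i = \<tau> i" if "\<not> i < n" for i
      using P that permutes_not_in[of \<sigma> "{..<n}" i] permutes_not_in[of \<tau> "{..<n}" i] by simp
    ultimately show "\<sigma> = \<tau>" by blast
  qed
  then have "card (?R ` ?P) = fact n"
    using card_permutations[of "{..<n}" n] by (simp add: card_image)
  moreover have "?R ` ?P = (\<lambda>e. result e ?t) ` ?E" by (simp add: image_image)
  ultimately show ?thesis
    using card_results_le[of ?E ?t c] num by metis
qed

section \<open>Asymptotics\<close>

text \<open>Half of Stirling's formula: the single term \<open>n ^ n / fact n\<close> of the series
  of \<open>exp n\<close> is at most the whole sum.\<close>

lemma ln_fact_ge: "real n * ln (real n) - real n \<le> ln (fact n)"
proof (cases "n = 0")
  case False
  have "(\<Sum>k\<in>{n}. real n ^ k /\<^sub>R fact k) \<le> exp (real n)"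
    unfolding exp_def by (rule sum_le_suminf[OF summable_exp_generic]) auto
  then have "real n ^ n \<le> exp (real n) * fact n"
    by (simp add: field_simps)
  then have "ln (real n ^ n) \<le> ln (exp (real n) * fact n)"
    using False by (subst ln_le_cancel_iff) auto
  also have "\<dots> = real n + ln (fact n)"
    by (simp add: ln_mult)
  finally show ?thesis by (simp add: ln_realpow False)
qed simp

theorem proposition3:
  shows "\<exists>C :: nat \<Rightarrow> nat. (\<forall>n. comparison_complexity n = enat (C n)) \<and>
    (\<lambda>n. real (C n)) \<in> \<Theta>(\<lambda>n. real n * ln (real n))"
proof -
  have upper: "comparison_complexity n \<le> enat (k * Suc n)" if "n < 2 ^ k" for n k
  proof -
    have "comparison_complexity n \<le> worst_case n (sorting_algorithm k)"
      unfolding comparison_complexity_def using sorting_algorithm(1)[OF that]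
      by (intro INF_lower) simp
    then show ?thesis using sorting_algorithm(2)[OF that] by (rule order_trans)
  qed
  \<comment> \<open>Taking \<open>k = n\<close> is wasteful but suffices for finiteness.\<close>
  have "\<exists>c. comparison_complexity n = enat c" for n
    using upper[OF less_exp[of n]] enat_ile by blast
  then obtain C where C: "\<And>n. comparison_complexity n = enat (C n)"
    by metis
  have fact_le: "fact n \<le> (3::nat) ^ C n" for n
  proof -
    have "strongly_solves n (sorting_algorithm n)"
      by (rule sorting_algorithm) (rule less_exp)
    \<comment> \<open>The sorting algorithm makes the set nonempty, so the infimum is
      attained.\<close>
    then have "comparison_complexity n \<in> worst_case n ` {alg. strongly_solves n alg}"
      unfolding comparison_complexity_def by (intro wellorder_InfI) auto
    then obtain alg where "strongly_solves n alg" "worst_case n alg = enat (C n)"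
      using C by auto
    then show ?thesis by (intro fact_le_power_worst_case) auto
  qed
  have "(\<lambda>n. real (C n)) \<in> O(\<lambda>n. real n * ln (real n))"
  \<comment> \<open>With \<open>l\<close> the integer part of the binary logarithm of
    \<open>n\<close>, \<open>ln 2 \<ge> 1 / 2\<close> gives \<open>l \<le> 2 * ln n\<close> and
    \<open>1 \<le> 2 * ln n\<close>. So \<open>Suc l \<le> 4 * ln n\<close>, and
    \<open>Suc n \<le> 2 * n\<close> contributes the remaining factor of \<open>8\<close>.\<close>
  proof (rule bigoI[where c = 8], rule eventually_mono[OF eventually_ge_at_top[of 2]])
    fix n :: nat assume n: "2 \<le> n"
    obtain l where l: "2 ^ l \<le> n" "n < 2 ^ Suc l"
      using ex_power_ivl1[of 2 n] n by auto
    have ln2: "1 / 2 \<le> ln (2::real)" by (subst ln_ge_iff) (simp_all only: exp_half_le2 zero_less_numeral)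
    have "real l * ln 2 = ln (real (2 ^ l))" by (simp add: ln_realpow)
    also have "\<dots> \<le> ln (real n)" using l(1) n by (subst ln_le_cancel_iff) (auto simp del: of_nat_power)
    finally have "real l * ln 2 \<le> ln (real n)" .
    moreover have "real l * (1 / 2) \<le> real l * ln 2" by (rule mult_left_mono[OF ln2]) simp
    moreover have "ln 2 \<le> ln (real n)" using n by simp
    ultimately have Suc_l: "real (Suc l) \<le> 4 * ln (real n)" using ln2 by simp
    have "C n \<le> Suc l * Suc n" using upper[OF l(2)] by (simp add: C)
    then have "real (C n) \<le> real (Suc l) * real (Suc n)"
      by (metis of_nat_le_iff of_nat_mult)
    also have "\<dots> \<le> (4 * ln (real n)) * (2 * real n)"
      using Suc_l n by (intro mult_mono) auto
    finally show "norm (real (C n)) \<le> 8 * norm (real n * ln (real n))"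
      using n by (simp add: abs_mult mult_ac)
  qed
  moreover have "(\<lambda>n. real n * ln (real n)) \<in> O(\<lambda>n. real (C n))"
  \<comment> \<open>From \<open>n \<ge> 9 \<ge> exp 2\<close> follows \<open>ln n \<ge> 2\<close>,
    so \<open>n * ln n - n\<close> is at least half of \<open>n * ln n\<close>. Bounding
    \<open>ln 3\<close> by \<open>2\<close> yields the other factor of \<open>2\<close>.\<close>
  proof (rule bigoI[where c = 4], rule eventually_mono[OF eventually_ge_at_top[of 9]])
    fix n :: nat assume n: "9 \<le> n"
    have "exp 2 = (exp 1 :: real) ^ 2" by (simp flip: exp_of_nat_mult)
    also have "\<dots> \<le> 3 ^ 2" using exp_le by (intro power_mono) auto
    finally have "exp 2 \<le> real n" using n by simp
    then have "2 \<le> ln (real n)" using n by (simp add: ln_ge_iff)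
    then have "real n * 2 \<le> real n * ln (real n)" by (intro mult_left_mono) auto
    moreover have "ln (fact n) \<le> real (C n) * ln 3"
    proof -
      have "(fact n :: real) \<le> 3 ^ C n" using fact_le[of n] by (metis of_nat_fact of_nat_le_iff of_nat_numeral of_nat_power)
      then have "ln (fact n :: real) \<le> ln (3 ^ C n)" by (subst ln_le_cancel_iff) auto
      then show ?thesis by (simp add: ln_realpow)
    qed
    moreover have "real (C n) * ln 3 \<le> real (C n) * 2"
      using ln_le_minus_one[of 3] by (intro mult_left_mono) auto
    ultimately have "real n * ln (real n) \<le> 4 * real (C n)"
      using ln_fact_ge[of n] by linarith
    then show "norm (real n * ln (real n)) \<le> 4 * norm (real (C n))"
      using n by (simp add: abs_mult)
  qed
  ultimately have "(\<lambda>n. real (C n)) \<in> \<Theta>(\<lambda>n. real n * ln (real n))"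
    by (simp add: bigtheta_def bigomega_iff_bigo)
  then show ?thesis using C by blast
qed

end
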